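(* Let $k,r,n,t$ be positive integers such that $2\le r\le k$ and $n\ge 3(k-1)(t-1)$, and let $U_1,\ldots,U_k$ be pairwise disjoint sets with $|U_i|=n$ for all $i\in[k]$. For each $i\in[t]$, let $i_1,\ldots,i_r\in[k]$ be pairwise distinct indices (which may depend on $i$) and let $\mathcal{F}_i\subseteq U_{i_1}\times\cdots\times U_{i_r}$ be such that $|\mathcal{F}_i|>(t-1)n^{r-1}$. Then $\{\mathcal{F}_1,\ldots,\mathcal{F}_t\}$ admits a rainbow matching.
   Context: For a positive integer $m$, $[m]:=\{1,\ldots,m\}$. Since the sets $U_j$ are pairwise disjoint, an element $(u_1,\ldots,u_r)$ of $U_{i_1}\times\cdots\times U_{i_r}$ is identified with the $r$-element set $\{u_1,\ldots,u_r\}$, and so $\mathcal{F}_i$ is regarded as an $r$-partite $r$-uniform hypergraph with partition classes $U_{i_1},\ldots,U_{i_r}$ and edge set $\mathcal{F}_i$. A rainbow matching for hypergraphs $\mathcal{F}_1,\ldots,\mathcal{F}_t$ is a choice of edges $e_i\in\mathcal{F}_i$, one for each $i\in[t]$, that are pairwise disjoint. The family $\{\mathcal{F}_1,\ldots,\mathcal{F}_t\}$ admits a rainbow matching if one exists; it is understood as an indexed family, in which the same hypergraph may occur several times. *)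

theory Defs
  imports Main "HOL-Library.FuncSet" "HOL-Library.Disjoint_Sets"
begin

text \<open>An \<open>r\<close>-tuple \<open>(u\<^sub>1, \<dots>, u\<^sub>r)\<close> is an extensional function on \<open>{1..r}\<close>, so that a product of
  sets is \<open>\<Pi>\<^sub>E j\<in>{1..r}. _\<close>. The following map identifies tuples with sets of entries; it is
  injective on a product of pairwise disjoint sets.\<close>

definition edge_of_tuple :: "nat \<Rightarrow> (nat \<Rightarrow> 'a) \<Rightarrow> 'a set" where
  "edge_of_tuple r u = u ` {1..r}"

definition hyperedges :: "nat \<Rightarrow> (nat \<Rightarrow> 'a) set \<Rightarrow> 'a set set" where
  "hyperedges r F = edge_of_tuple r ` F"

text \<open>A hypergraph is given by its edge set. Families of hypergraphs are indexed by \<open>{1..t}\<close>, so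
  repetitions are allowed, and the edges chosen for different indices must be disjoint even
  when the hypergraphs coincide.\<close>

definition rainbow_matching :: "nat \<Rightarrow> (nat \<Rightarrow> 'a set set) \<Rightarrow> (nat \<Rightarrow> 'a set) \<Rightarrow> bool" where
  "rainbow_matching t H e \<longleftrightarrow> (\<forall>i\<in>{1..t}. e i \<in> H i) \<and> disjoint_family_on e {1..t}"

definition admits_rainbow_matching :: "nat \<Rightarrow> (nat \<Rightarrow> 'a set set) \<Rightarrow> bool" where
  "admits_rainbow_matching t H \<longleftrightarrow> (\<exists>e. rainbow_matching t H e)"

end

theory Submission
  imports Defs
begin

text \<open>
  Write \<open>\<tau> = t - 1\<close> and call the number of edges of a hypergraph through a vertex the degree of
  that vertex. The proof is a double induction, first on the uniformity \<open>r\<close> and, for each \<open>r\<close>, on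
  the number \<open>t\<close> of hypergraphs. For \<open>r = 1\<close> it suffices to choose distinct representatives. For
  \<open>r \<ge> 2\<close>, there are three cases.

  Suppose that some vertex \<open>v\<close> has degree more than \<open>(r - 1) \<tau> n\<^sup>r\<^sup>-\<^sup>2\<close> in some \<open>F\<^sub>i\<close>. Deleting \<open>v\<close> costs
  every other hypergraph at most \<open>n\<^sup>r\<^sup>-\<^sup>1\<close> edges, which is just what the bound for \<open>t - 1\<close> hypergraphs
  can spare, so these have a rainbow matching that avoids \<open>v\<close>. Its \<open>\<tau>\<close> edges have at most
  \<open>(r - 1) \<tau>\<close> vertices in the other classes of \<open>F\<^sub>i\<close>, and each of them lies in at most \<open>n\<^sup>r\<^sup>-\<^sup>2\<close> edges
  through \<open>v\<close>. Hence an edge of \<open>F\<^sub>i\<close> through \<open>v\<close> completes the matching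
  (\<open>extend_at_heavy_vertex\<close>).

  Otherwise all degrees are at most \<open>(r - 1) \<tau> n\<^sup>r\<^sup>-\<^sup>2\<close>. Let \<open>A\<^sub>i\<close> be the set of vertices whose degree in
  \<open>F\<^sub>i\<close> exceeds \<open>2 \<tau> n\<^sup>r\<^sup>-\<^sup>2\<close>. If some \<open>A\<^sub>i\<close> has at most \<open>\<tau>\<close> elements, take any rainbow matching of the
  other hypergraphs. Of the at most \<open>r \<tau>\<close> vertices that it uses in the classes of \<open>F\<^sub>i\<close>, at most \<open>\<tau>\<close>
  are in \<open>A\<^sub>i\<close>, so (for \<open>r \<ge> 3\<close>) it meets at most
  \<open>\<tau> (r - 1) \<tau> n\<^sup>r\<^sup>-\<^sup>2 + (r - 1) \<tau> 2 \<tau> n\<^sup>r\<^sup>-\<^sup>2 = 3 (r - 1) \<tau>\<^sup>2 n\<^sup>r\<^sup>-\<^sup>2 \<le> \<tau> n\<^sup>r\<^sup>-\<^sup>1\<close> edges of \<open>F\<^sub>i\<close>, and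
  another edge is left (\<open>extend_with_few_heavy_vertices\<close>). This is where the constant 3 arises.

  If every \<open>A\<^sub>i\<close> has at least \<open>t\<close> elements, choose distinct \<open>v\<^sub>i \<in> A\<^sub>i\<close>. Even after the other chosen
  vertices are deleted, the link of \<open>v\<^sub>i\<close> in \<open>F\<^sub>i\<close> keeps more than \<open>\<tau> n\<^sup>r\<^sup>-\<^sup>2\<close> edges, so the induction
  on \<open>r\<close> gives a rainbow matching of the links, to which the \<open>v\<^sub>i\<close> are added (\<open>reduce_to_links\<close>).
  The \<open>v\<^sub>i\<close> may lie in different classes; therefore the induction needs the form of the theorem
  in which each hypergraph has its own \<open>r\<close> classes.

  Edges are treated as sets of vertices that meet each class of their hypergraph exactly once;
  the last section identifies tuples with such sets.
\<close>

section \<open>Greedy choices\<close>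

text \<open>The crudest case of Hall's theorem: the representatives can be picked one after another, as
  each set is larger than the number of elements already used.\<close>

lemma distinct_representatives:
  assumes "finite I" and "\<And>i. i \<in> I \<Longrightarrow> card I \<le> card (A i)"
  shows "\<exists>v. (\<forall>i\<in>I. v i \<in> A i) \<and> inj_on v I"
  using assms
proof (induction I rule: finite_induct)
  case empty
  then show ?case by simp
next
  case (insert i I)
  have "card I \<le> card (A l)" if "l \<in> I" for l
    using insert.prems[of l] insert.hyps that by simp
  then obtain v where v: "\<forall>l\<in>I. v l \<in> A l" "inj_on v I"
    using insert.IH by blast
  have "card (v ` I) < card (A i)"
    using insert.prems[of i] insert.hyps card_image_le[of I v] by simp
  then have "\<not> A i \<subseteq> v ` I"
    using card_mono[of "v ` I" "A i"] insert.hyps by auto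
  then obtain x where x: "x \<in> A i" "x \<notin> v ` I" by blast
  have "inj_on (v(i := x)) (insert i I)"
    using v(2) x(2) insert.hyps(2) by (auto simp: inj_on_def)
  moreover have "\<forall>l\<in>insert i I. (v(i := x)) l \<in> A l"
    using v(1) x(1) insert.hyps(2) by auto
  ultimately show ?case by blast
qed

definition degree :: "'a set set \<Rightarrow> 'a \<Rightarrow> nat" where
  "degree H v = card {e \<in> H. v \<in> e}"

definition link :: "'a set set \<Rightarrow> 'a \<Rightarrow> 'a set set" where
  "link H v = (\<lambda>e. e - {v}) ` {e \<in> H. v \<in> e}"

lemma card_link: "card (link H v) = degree H v"
  unfolding link_def degree_def by (rule card_image) (auto simp: inj_on_def)

lemma link_insert: "g \<in> link H v \<Longrightarrow> insert v g \<in> H"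
  unfolding link_def by (auto simp: insert_absorb)

lemma card_edges_meeting_le:
  assumes "finite H" and "finite W"
  shows "card {e \<in> H. e \<inter> W \<noteq> {}} \<le> (\<Sum>w\<in>W. degree H w)"
proof -
  have "{e \<in> H. e \<inter> W \<noteq> {}} = (\<Union>w\<in>W. {e \<in> H. w \<in> e})"
    by auto
  then show ?thesis
    unfolding degree_def using card_UN_le[OF assms(2), of "\<lambda>w. {e \<in> H. w \<in> e}"] by simp
qed

text \<open>Greedy completion: the vertices already used block at most as many edges as the sum of their
  degrees.\<close>

lemma edge_avoiding:
  assumes "finite H" and "finite W" and "(\<Sum>w\<in>W. degree H w) < card H"
  obtains e where "e \<in> H" and "e \<inter> W = {}"
proof -
  have "card {e \<in> H. e \<inter> W \<noteq> {}} < card H"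
    using card_edges_meeting_le[OF assms(1,2)] assms(3) by linarith
  then have "{e \<in> H. e \<inter> W \<noteq> {}} \<noteq> H" 
    by (metis less_irrefl)
  then show ?thesis using that by blast
qed

lemma card_edges_avoiding_ge:
  assumes "finite H" and "finite W"
  shows "card H \<le> card {e \<in> H. e \<inter> W = {}} + (\<Sum>w\<in>W. degree H w)"
proof -
  have split: "{e \<in> H. e \<inter> W = {}} \<union> {e \<in> H. e \<inter> W \<noteq> {}} = H" by blast
  have "card H \<le> card {e \<in> H. e \<inter> W = {}} + card {e \<in> H. e \<inter> W \<noteq> {}}"
    using card_Un_le[of "{e \<in> H. e \<inter> W = {}}" "{e \<in> H. e \<inter> W \<noteq> {}}"]
    by (simp only: split)
  then show ?thesis
    using card_edges_meeting_le[OF assms] by linarith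
qed

section \<open>Transversals of vertex classes\<close>

definition transversals :: "('p \<Rightarrow> 'a set) \<Rightarrow> 'p set \<Rightarrow> 'a set set" where
  "transversals U J = {e. e \<subseteq> \<Union> (U ` J) \<and> (\<forall>p\<in>J. \<exists>!x. x \<in> e \<inter> U p)}"

locale vertex_classes =
  fixes U :: "'p \<Rightarrow> 'a set" and P :: "'p set" and n :: nat
  assumes disjoint_classes: "disjoint_family_on U P"
    and finite_class: "\<And>p. p \<in> P \<Longrightarrow> finite (U p)"
    and card_class_le: "\<And>p. p \<in> P \<Longrightarrow> card (U p) \<le> n"
begin

lemma class_unique: "p \<in> P \<Longrightarrow> q \<in> P \<Longrightarrow> x \<in> U p \<Longrightarrow> x \<in> U q \<Longrightarrow> p = q"
  using disjoint_classes unfolding disjoint_family_on_def by blast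

text \<open>A transversal of \<open>J\<close> is the image of the function that selects its element in each class, so
  there are at most as many transversals as selections.\<close>

lemma transversals_finite_card:
  assumes "J \<subseteq> P" and "finite J"
  shows "finite (transversals U J) \<and> card (transversals U J) \<le> n ^ card J"
proof -
  have sub: "transversals U J \<subseteq> (\<lambda>f. f ` J) ` (\<Pi>\<^sub>E p\<in>J. U p)"
  proof
    fix e assume e: "e \<in> transversals U J"
    define f where "f = (\<lambda>p\<in>J. THE x. x \<in> e \<inter> U p)"
    have f: "f p \<in> e \<inter> U p" if "p \<in> J" for p
      using e that theI'[of "\<lambda>x. x \<in> e \<inter> U p"] unfolding transversals_def f_def by simp
    have "e = f ` J"
    proof
      show "f ` J \<subseteq> e" using f by blast
      show "e \<subseteq> f ` J"
      proof
        fix x assume "x \<in> e"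
        then obtain p where p: "p \<in> J" "x \<in> U p"
          using e unfolding transversals_def by blast
        then have "x = f p"
          using e \<open>x \<in> e\<close> f[of p] unfolding transversals_def by blast
        then show "x \<in> f ` J" using p by blast
      qed
    qed
    moreover have "f \<in> (\<Pi>\<^sub>E p\<in>J. U p)"
      using f by (auto simp: f_def)
    ultimately show "e \<in> (\<lambda>f. f ` J) ` (\<Pi>\<^sub>E p\<in>J. U p)" by blast
  qed
  have fin: "finite (\<Pi>\<^sub>E p\<in>J. U p)"
    using assms finite_class by (intro finite_PiE) auto
  have "card (\<Pi>\<^sub>E p\<in>J. U p) = (\<Prod>p\<in>J. card (U p))"
    using card_PiE[OF assms(2)] by blast
  also have "\<dots> \<le> (\<Prod>p\<in>J. n)"
    using assms card_class_le by (intro prod_mono) auto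
  finally have "card (\<Pi>\<^sub>E p\<in>J. U p) \<le> n ^ card J" by simp
  then show ?thesis
    using sub fin by (meson card_image_le card_mono finite_imageI finite_subset le_trans)
qed

lemma transversal_Int_classes:
  assumes "e \<in> transversals U J" and "J \<subseteq> P" and "K \<subseteq> P" and "finite K"
  shows "finite (e \<inter> \<Union> (U ` K)) \<and> card (e \<inter> \<Union> (U ` K)) \<le> card K"
proof -
  have eq: "e \<inter> \<Union> (U ` K) = (\<Union>p\<in>K. e \<inter> U p)" by blast
  have one: "card (e \<inter> U p) \<le> 1" if "p \<in> K" for p
  proof (cases "p \<in> J")
    case True
    then obtain x where "e \<inter> U p = {x}"
      using assms(1) unfolding transversals_def by blast
    then show ?thesis by simp
  next
    case False
    then have "e \<inter> U p = {}"
      using assms(1-3) that class_unique[of p] unfolding transversals_def by blast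
    then show ?thesis by simp
  qed
  have "card (\<Union>p\<in>K. e \<inter> U p) \<le> (\<Sum>p\<in>K. card (e \<inter> U p))"
    by (rule card_UN_le[OF assms(4)])
  also have "\<dots> \<le> (\<Sum>p\<in>K. 1)"
    by (rule sum_mono) (rule one)
  finally have "card (e \<inter> \<Union> (U ` K)) \<le> card K"
    by (simp only: eq card_eq_sum)
  moreover have "finite (\<Union> (U ` K))"
    using assms(3,4) finite_class by blast
  ultimately show ?thesis by blast
qed

lemma link_transversals:
  assumes "H \<subseteq> transversals U J" and "J \<subseteq> P" and "p \<in> J" and "v \<in> U p"
  shows "link H v \<subseteq> transversals U (J - {p})"
proof
  fix g assume "g \<in> link H v"
  then obtain e where e: "e \<in> H" "v \<in> e" "g = e - {v}"
    unfolding link_def by blast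
  then have eT: "e \<subseteq> \<Union> (U ` J)" "\<forall>q\<in>J. \<exists>!x. x \<in> e \<inter> U q"
    using assms(1) unfolding transversals_def by blast+
  have at_p: "e \<inter> U p = {v}"
    using eT(2) assms(3,4) e(2) by blast
  have "v \<notin> U q" if "q \<in> J - {p}" for q
    using that assms class_unique[of p q v] by blast
  then have rest: "g \<inter> U q = e \<inter> U q" if "q \<in> J - {p}" for q
    using that e(3) by blast
  have "g \<subseteq> \<Union> (U ` (J - {p}))"
  proof
    fix x assume "x \<in> g"
    then have x: "x \<in> e" "x \<noteq> v" using e(3) by auto
    then obtain q where q: "q \<in> J" "x \<in> U q" using eT(1) by blast
    then have "q \<noteq> p" using x at_p by blast
    then show "x \<in> \<Union> (U ` (J - {p}))" using q by blast
  qed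
  moreover have "\<exists>!x. x \<in> g \<inter> U q" if "q \<in> J - {p}" for q
    unfolding rest[OF that] using eT(2) that by blast
  ultimately show "g \<in> transversals U (J - {p})"
    unfolding transversals_def by blast
qed

lemma degree_pos_class:
  assumes "H \<subseteq> transversals U J" and "0 < degree H v"
  obtains p where "p \<in> J" and "v \<in> U p"
proof -
  have "{e \<in> H. v \<in> e} \<noteq> {}"
    using assms(2) unfolding degree_def by (metis card.empty less_irrefl)
  then obtain e where "e \<in> H" "v \<in> e" by blast
  then show ?thesis
    using that assms(1) unfolding transversals_def by blast
qed

text \<open>The degree of \<open>v\<close> counts the edges of its link, which are transversals of one class fewer.
  Applied to a link, this also bounds the number of edges through two vertices.\<close>

lemma degree_le:
  assumes "H \<subseteq> transversals U J" and "J \<subseteq> P" and "finite J" 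
  shows "degree H v \<le> n ^ (card J - 1)"
proof (cases "\<exists>p\<in>J. v \<in> U p")
  case True
  then obtain p where p: "p \<in> J" "v \<in> U p" by blast
  have "card (link H v) \<le> card (transversals U (J - {p}))"
    using transversals_finite_card[of "J - {p}"] link_transversals[OF assms(1,2) p] assms(2,3)
    by (intro card_mono) auto
  also have "\<dots> \<le> n ^ card (J - {p})"
    using transversals_finite_card[of "J - {p}"] assms(2,3) by auto
  finally show ?thesis
    using p assms(3) by (simp add: card_link)
next
  case False
  then have "{e \<in> H. v \<in> e} = {}"
    using assms(1) unfolding transversals_def by blast
  then show ?thesis unfolding degree_def by (simp only: card.empty)
qed

text \<open>Restricting to the classes in \<open>K\<close> matters: edges for other indices may use other classes, and
  only their vertices in the classes of a given hypergraph can block its edges.\<close>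

lemma matching_Int_classes:
  assumes "finite I" and "\<And>l. l \<in> I \<Longrightarrow> J l \<subseteq> P"
    and "\<And>l. l \<in> I \<Longrightarrow> e l \<in> transversals U (J l)" and "K \<subseteq> P" and "finite K"
  shows "finite (\<Union> (e ` I) \<inter> \<Union> (U ` K)) \<and>
    card (\<Union> (e ` I) \<inter> \<Union> (U ` K)) \<le> card I * card K"
proof -
  have eq: "\<Union> (e ` I) \<inter> \<Union> (U ` K) = (\<Union>l\<in>I. e l \<inter> \<Union> (U ` K))" by blast
  have one: "finite (e l \<inter> \<Union> (U ` K)) \<and> card (e l \<inter> \<Union> (U ` K)) \<le> card K" if "l \<in> I" for l
    by (rule transversal_Int_classes[OF assms(3)[OF that] assms(2)[OF that] assms(4,5)])
  have "card (\<Union>l\<in>I. e l \<inter> \<Union> (U ` K)) \<le> (\<Sum>l\<in>I. card (e l \<inter> \<Union> (U ` K)))"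
    by (rule card_UN_le[OF assms(1)])
  also have "\<dots> \<le> (\<Sum>l\<in>I. card K)"
    by (rule sum_mono) (use one in blast)
  finally have "card (\<Union> (e ` I) \<inter> \<Union> (U ` K)) \<le> card I * card K"
    by (simp only: eq sum_constant of_nat_id)
  moreover have "finite (\<Union>l\<in>I. e l \<inter> \<Union> (U ` K))"
    using one assms(1) by blast
  ultimately show ?thesis by (simp only: eq)
qed

end

section \<open>Rainbow matchings\<close>

lemma disjoint_family_on_extend:
  assumes "disjoint_family_on e (I - {i})" and "\<And>l. l \<in> I - {i} \<Longrightarrow> x \<inter> e l = {}"
  shows "disjoint_family_on (e(i := x)) I"
  unfolding disjoint_family_on_def
proof (intro ballI impI)
  fix a b assume "a \<in> I" "b \<in> I" "a \<noteq> b"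
  moreover have "e a \<inter> e b = {}" if "a \<noteq> i" "b \<noteq> i"
    using assms(1) that \<open>a \<in> I\<close> \<open>b \<in> I\<close> \<open>a \<noteq> b\<close> unfolding disjoint_family_on_def by simp
  ultimately show "(e(i := x)) a \<inter> (e(i := x)) b = {}"
    using assms(2)[of a] assms(2)[of b] by (cases "a = i"; cases "b = i") (simp_all add: Int_commute)
qed

context vertex_classes
begin

definition uniform_family :: "nat \<Rightarrow> 'i set \<Rightarrow> ('i \<Rightarrow> 'p set) \<Rightarrow> ('i \<Rightarrow> 'a set set) \<Rightarrow> bool" where
  "uniform_family r I J H \<longleftrightarrow>
    (\<forall>i\<in>I. J i \<subseteq> P \<and> finite (J i) \<and> card (J i) = r \<and> H i \<subseteq> transversals U (J i))"

lemma uniform_familyD: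
  assumes "uniform_family r I J H" and "i \<in> I"
  shows "J i \<subseteq> P" "finite (J i)" "card (J i) = r" "H i \<subseteq> transversals U (J i)" "finite (H i)"
proof -
  show *: "J i \<subseteq> P" "finite (J i)" "card (J i) = r" "H i \<subseteq> transversals U (J i)"
    using assms unfolding uniform_family_def by blast+
  then show "finite (H i)"
    using transversals_finite_card finite_subset by blast
qed

text \<open>In the next three lemmas the uniformity is \<open>q + 1\<close> and \<open>card I - 1\<close> is the number \<open>\<tau>\<close> of other
  edges. Completing inside the link of \<open>v\<close> pays off because a further vertex blocks at most
  \<open>n\<^sup>q\<^sup>-\<^sup>1\<close> of its edges, and only the \<open>q\<close> classes other than that of \<open>v\<close> contribute blocking
  vertices.\<close>

lemma extend_at_heavy_vertex:
  assumes fam: "uniform_family (Suc q) I J H" and "finite I" and i: "i \<in> I"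
    and heavy: "q * (card I - 1) * n ^ (q - 1) < degree (H i) v"
    and e: "\<And>l. l \<in> I - {i} \<Longrightarrow> e l \<in> H l" "\<And>l. l \<in> I - {i} \<Longrightarrow> v \<notin> e l"
    and disj: "disjoint_family_on e (I - {i})"
  shows "\<exists>f. (\<forall>l\<in>I. f l \<in> H l) \<and> disjoint_family_on f I"
proof -
  note Ji = uniform_familyD[OF fam i]
  obtain p where p: "p \<in> J i" "v \<in> U p"
    using degree_pos_class[OF Ji(4)] heavy by (metis gr_zeroI not_less0)
  let ?K = "J i - {p}"
  have L: "link (H i) v \<subseteq> transversals U ?K"
    by (rule link_transversals[OF Ji(4,1) p])
  have K: "?K \<subseteq> P" "finite ?K" "card ?K = q"
    using Ji p by auto
  let ?W = "\<Union> (e ` (I - {i})) \<inter> \<Union> (U ` ?K)"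
  have W: "finite ?W \<and> card ?W \<le> card (I - {i}) * card ?K"
  proof (rule matching_Int_classes[where J = J])
    fix l assume "l \<in> I - {i}"
    then show "J l \<subseteq> P" "e l \<in> transversals U (J l)"
      using uniform_familyD(1,4)[OF fam, of l] e(1)[of l] by auto
  qed (use K \<open>finite I\<close> in simp_all)
  have "(\<Sum>w\<in>?W. degree (link (H i) v) w) \<le> (\<Sum>w\<in>?W. n ^ (q - 1))"
    using degree_le[OF L K(1,2)] K(3) by (intro sum_mono) simp
  also have "\<dots> \<le> (card (I - {i}) * q) * n ^ (q - 1)"
    using W K(3) by simp
  also have "\<dots> = q * (card I - 1) * n ^ (q - 1)"
    using i \<open>finite I\<close> by simp
  finally have "(\<Sum>w\<in>?W. degree (link (H i) v) w) < card (link (H i) v)"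
    using heavy by (simp add: card_link)
  moreover have "finite (link (H i) v)"
    using Ji(5) unfolding link_def by simp
  ultimately obtain g where g: "g \<in> link (H i) v" "g \<inter> ?W = {}"
    using W edge_avoiding by metis
  have "g \<subseteq> \<Union> (U ` ?K)"
    using g(1) L unfolding transversals_def by blast
  then have "insert v g \<inter> e l = {}" if "l \<in> I - {i}" for l
    using that g(2) e(2)[OF that] by blast
  then have "disjoint_family_on (e(i := insert v g)) I"
    by (rule disjoint_family_on_extend[OF disj])
  moreover have "\<forall>l\<in>I. (e(i := insert v g)) l \<in> H l"
    using e(1) link_insert[OF g(1)] by auto
  ultimately show ?thesis by blast
qed

text \<open>Let \<open>q \<ge> 2\<close>. Each of the at most \<open>\<tau>\<close> vertices of degree above \<open>2 \<tau> n\<^sup>q\<^sup>-\<^sup>1\<close> blocks at most \<open>q \<tau> n\<^sup>q\<^sup>-\<^sup>1\<close> edges.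
  Hence even if all of them are used, they block no more than \<open>q \<tau>\<^sup>2 n\<^sup>q\<^sup>-\<^sup>1\<close> edges, one third of
  what the bound on \<open>n\<close> permits, and the other two thirds cover the remaining \<open>q \<tau>\<close> vertices. If \<open>q = 1\<close>, a cruder count suffices.\<close>

lemma extend_with_few_heavy_vertices:
  assumes fam: "uniform_family (Suc q) I J H" and "finite I" and i: "i \<in> I"
    and "1 \<le> q" and n: "3 * q * (card I - 1) \<le> n"
    and large: "(card I - 1) * n ^ q < card (H i)"
    and bounded: "\<And>v. degree (H i) v \<le> q * (card I - 1) * n ^ (q - 1)"
    and few: "card {v. 2 * (card I - 1) * n ^ (q - 1) < degree (H i) v} \<le> card I - 1"
    and finite_heavy: "finite {v. 2 * (card I - 1) * n ^ (q - 1) < degree (H i) v}"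
    and e: "\<And>l. l \<in> I - {i} \<Longrightarrow> e l \<in> H l"
    and disj: "disjoint_family_on e (I - {i})"
  shows "\<exists>f. (\<forall>l\<in>I. f l \<in> H l) \<and> disjoint_family_on f I"
proof -
  note Ji = uniform_familyD[OF fam i]
  define \<tau> where "\<tau> = card I - 1"
  define N where "N = n ^ (q - 1)"
  define A where "A = {v. 2 * \<tau> * N < degree (H i) v}"
  let ?W = "\<Union> (e ` (I - {i})) \<inter> \<Union> (U ` J i)"
  have "finite ?W \<and> card ?W \<le> card (I - {i}) * card (J i)"
  proof (rule matching_Int_classes[where J = J])
    fix l assume "l \<in> I - {i}"
    then show "J l \<subseteq> P" "e l \<in> transversals U (J l)"
      using uniform_familyD(1,4)[OF fam, of l] e[of l] by auto
  qed (use Ji \<open>finite I\<close> in simp_all)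
  then have W: "finite ?W" "card ?W \<le> \<tau> * Suc q"
    using i \<open>finite I\<close> Ji(3) by (simp_all add: \<tau>_def)
  have WA: "card (?W \<inter> A) \<le> \<tau>"
    using card_mono[of A "?W \<inter> A"] few finite_heavy unfolding A_def \<tau>_def N_def
    by (meson Int_lower2 card_mono le_trans)
  have "(\<Sum>w\<in>?W. degree (H i) w) \<le> (3 * q * \<tau>) * (\<tau> * N)"
  proof (cases "q = 1")
    case True
    \<comment> \<open>Here the bound on all degrees is below the threshold \<open>2 \<tau> N\<close>, and \<open>2 \<tau>\<close> vertices of degree at
      most \<open>\<tau>\<close> are few enough.\<close>
    have "(\<Sum>w\<in>?W. degree (H i) w) \<le> (\<Sum>w\<in>?W. \<tau> * N)"
      using bounded True by (intro sum_mono) (simp add: \<tau>_def N_def)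
    also have "\<dots> = card ?W * (\<tau> * N)" by simp
    also have "\<dots> \<le> (3 * q * \<tau>) * (\<tau> * N)"
      using W(2) True by (intro mult_right_mono) auto
    finally show ?thesis .
  next
    case False
    then have "q = (q - 2) + 2"
      using \<open>1 \<le> q\<close> by simp
    then obtain m where m: "q = m + 2" by blast
    \<comment> \<open>A vertex in \<open>A\<close> is charged the common amount \<open>2 \<tau> N\<close> and a surcharge that brings it to
      \<open>q \<tau> N\<close>.\<close>
    have "degree (H i) w \<le> 2 * (\<tau> * N) + (if w \<in> A then m * (\<tau> * N) else 0)" for w
      using bounded[of w] unfolding A_def m \<tau>_def N_def by (auto simp: algebra_simps)
    then have "(\<Sum>w\<in>?W. degree (H i) w)
        \<le> (\<Sum>w\<in>?W. 2 * (\<tau> * N) + (if w \<in> A then m * (\<tau> * N) else 0))"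
      by (intro sum_mono) blast
    also have "\<dots> = (card ?W * 2 + card (?W \<inter> A) * m) * (\<tau> * N)"
      using W(1) by (simp add: sum.distrib sum.If_cases algebra_simps)
    also have "\<dots> \<le> ((\<tau> * Suc q) * 2 + \<tau> * m) * (\<tau> * N)"
      using W(2) WA by (intro mult_right_mono add_mono) auto
    also have "\<dots> = (3 * q * \<tau>) * (\<tau> * N)"
      unfolding m by (simp add: algebra_simps)
    finally show ?thesis .
  qed
  also have "\<dots> \<le> n * (\<tau> * N)"
    using n by (intro mult_right_mono) (simp_all add: \<tau>_def)
  also have "\<dots> = \<tau> * n ^ q"
    using \<open>1 \<le> q\<close> by (cases q) (simp_all add: N_def)
  finally have "(\<Sum>w\<in>?W. degree (H i) w) < card (H i)"
    using large by (simp add: \<tau>_def)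
  then obtain x where x: "x \<in> H i" "x \<inter> ?W = {}"
    using edge_avoiding[OF Ji(5) W(1)] by metis
  have "x \<subseteq> \<Union> (U ` J i)"
    using x(1) Ji(4) unfolding transversals_def by blast
  then have "x \<inter> e l = {}" if "l \<in> I - {i}" for l
    using that x(2) by blast
  then have "disjoint_family_on (e(i := x)) I"
    by (rule disjoint_family_on_extend[OF disj])
  moreover have "\<forall>l\<in>I. (e(i := x)) l \<in> H l"
    using e x(1) by auto
  ultimately show ?thesis by blast
qed

text \<open>The threshold \<open>2 \<tau> n\<^sup>q\<^sup>-\<^sup>1\<close> leaves \<open>\<tau> n\<^sup>q\<^sup>-\<^sup>1\<close> for the induction hypothesis after \<open>\<tau> n\<^sup>q\<^sup>-\<^sup>1\<close> has been spent
  on deleting from each link the vertices \<open>v l\<close> chosen for the other hypergraphs.\<close>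

lemma reduce_to_links:
  assumes fam: "uniform_family (Suc q) I J H" and "finite I"
    and v: "\<And>i. i \<in> I \<Longrightarrow> 2 * (card I - 1) * n ^ (q - 1) < degree (H i) (v i)"
    and inj: "inj_on v I"
    and IH: "\<And>J' G. uniform_family q I J' G \<Longrightarrow>
      (\<And>i. i \<in> I \<Longrightarrow> (card I - 1) * n ^ (q - 1) < card (G i)) \<Longrightarrow>
      \<exists>g. (\<forall>i\<in>I. g i \<in> G i) \<and> disjoint_family_on g I"
  shows "\<exists>f. (\<forall>i\<in>I. f i \<in> H i) \<and> disjoint_family_on f I"
proof -
  have "\<exists>p. p \<in> J i \<and> v i \<in> U p" if i: "i \<in> I" for i
  proof -
    have "0 < degree (H i) (v i)"
      using v[OF i] by (rule le_less_trans[OF le0])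
    with uniform_familyD(4)[OF fam i] obtain p where "p \<in> J i" "v i \<in> U p"
      by (rule degree_pos_class)
    then show ?thesis by (intro exI conjI)
  qed
  then have "\<exists>p. \<forall>i\<in>I. p i \<in> J i \<and> v i \<in> U (p i)"
    by (intro bchoice ballI)
  then obtain p where "\<forall>i\<in>I. p i \<in> J i \<and> v i \<in> U (p i)" by (rule exE)
  then have p: "p i \<in> J i" "v i \<in> U (p i)" if "i \<in> I" for i
    using that by simp_all
  define J' where "J' = (\<lambda>i. J i - {p i})"
  define G where "G = (\<lambda>i. {g \<in> link (H i) (v i). g \<inter> v ` (I - {i}) = {}})"
  have L: "link (H i) (v i) \<subseteq> transversals U (J' i)" if "i \<in> I" for i
    unfolding J'_def
    using link_transversals[OF uniform_familyD(4)[OF fam that] uniform_familyD(1)[OF fam that]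
        p(1)[OF that] p(2)[OF that]] .
  have J': "J' i \<subseteq> P" "finite (J' i)" "card (J' i) = q" if "i \<in> I" for i
    using uniform_familyD[OF fam that] p(1)[OF that] by (auto simp: J'_def)
  have "uniform_family q I J' G"
    unfolding uniform_family_def
  proof (intro ballI conjI)
    fix i assume i: "i \<in> I"
    show "J' i \<subseteq> P" "finite (J' i)" "card (J' i) = q" by (rule J'[OF i])+
    show "G i \<subseteq> transversals U (J' i)"
      unfolding G_def by (rule subset_trans[OF Collect_restrict L[OF i]])
  qed
  moreover have "(card I - 1) * n ^ (q - 1) < card (G i)" if "i \<in> I" for i
  proof -
    let ?V = "v ` (I - {i})"
    have fin: "finite (link (H i) (v i))"
      using uniform_familyD(5)[OF fam that] unfolding link_def by simp
    have "(\<Sum>w\<in>?V. degree (link (H i) (v i)) w) \<le> (\<Sum>w\<in>?V. n ^ (q - 1))"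
      using degree_le[OF L[OF that] J'(1,2)[OF that]] J'(3)[OF that] by (intro sum_mono) simp
    also have "\<dots> \<le> (card I - 1) * n ^ (q - 1)"
      using card_image_le[of "I - {i}" v] \<open>finite I\<close> that by simp
    finally have "degree (H i) (v i) \<le> card (G i) + (card I - 1) * n ^ (q - 1)"
      using card_edges_avoiding_ge[OF fin, of ?V] \<open>finite I\<close> by (simp add: card_link G_def)
    then show ?thesis
      using v[OF that] by simp
  qed
  ultimately have "\<exists>g. (\<forall>i\<in>I. g i \<in> G i) \<and> disjoint_family_on g I"
    by (rule IH)
  then obtain g where g: "\<forall>i\<in>I. g i \<in> G i" "disjoint_family_on g I"
    by (elim exE conjE)
  have "insert (v i) (g i) \<inter> insert (v l) (g l) = {}" if "i \<in> I" "l \<in> I" "i \<noteq> l" for i l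
  proof -
    have "v i \<noteq> v l" using inj that by (auto dest: inj_onD)
    moreover have "g i \<inter> g l = {}"
      using g(2) that unfolding disjoint_family_on_def by blast
    moreover have "v l \<notin> g i" "v i \<notin> g l"
      using g(1) that unfolding G_def by blast+
    ultimately show ?thesis by blast
  qed
  then have "disjoint_family_on (\<lambda>i. insert (v i) (g i)) I"
    unfolding disjoint_family_on_def by blast
  moreover have "\<forall>i\<in>I. insert (v i) (g i) \<in> H i"
    using g(1) by (simp add: G_def link_insert)
  ultimately show ?thesis by (intro exI[of _ "\<lambda>i. insert (v i) (g i)"]) blast
qed

text \<open>The index set is an arbitrary finite set, so that any hypergraph can be set aside for the end.
  Since \<open>card I - 1\<close> is truncated, a single hypergraph is an instance of the general step:
  setting it aside leaves the empty family.\<close>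

theorem rainbow_matching_of_transversals:
  assumes "1 \<le> r" and "finite I" and "3 * (r - 1) * (card I - 1) \<le> n"
    and "uniform_family r I J H"
    and "\<And>i. i \<in> I \<Longrightarrow> (card I - 1) * n ^ (r - 1) < card (H i)"
  shows "\<exists>f. (\<forall>i\<in>I. f i \<in> H i) \<and> disjoint_family_on f I"
  using assms
proof (induction r arbitrary: I J H rule: nat_induct_at_least)
  case base
  have "card I \<le> card (H i)" if "i \<in> I" for i
    using base(4)[OF that] by simp
  then obtain f where f: "\<forall>i\<in>I. f i \<in> H i" "inj_on f I"
    using distinct_representatives[OF base(1), of H] by blast
  have single: "\<exists>x. f i = {x}" if "i \<in> I" for i
  proof -
    note Ji = uniform_familyD[OF base(3) that]
    obtain p where "J i = {p}"
      using Ji(3) card_1_singletonE by metis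
    moreover have "f i \<in> transversals U (J i)"
      using f(1) that Ji(4) by blast
    ultimately have "f i \<subseteq> U p" "\<exists>!x. x \<in> f i \<inter> U p"
      unfolding transversals_def by auto
    then show ?thesis by blast
  qed
  have "disjoint_family_on f I"
    unfolding disjoint_family_on_def
  proof (intro ballI impI)
    fix i l assume il: "i \<in> I" "l \<in> I" "i \<noteq> l"
    then have "f i \<noteq> f l" using f(2) by (auto dest: inj_onD)
    then show "f i \<inter> f l = {}"
      using single[OF il(1)] single[OF il(2)] by auto
  qed
  then show ?case using f(1) by blast
next
  case (Suc q)
  note IHq = Suc.IH
  show ?case
    using Suc.prems
  proof (induction I arbitrary: H rule: finite_psubset_induct)
    case (psubset I)
    have n: "3 * q * (card I - 1) \<le> n" using psubset.prems(1) by simp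
    have fam: "uniform_family (Suc q) I J H" by (rule psubset.prems(2))
    have large: "(card I - 1) * n ^ q < card (H i)" if "i \<in> I" for i
      using psubset.prems(3)[OF that] by simp
    \<comment> \<open>One index fewer lowers the required size by \<open>n ^ q\<close>, so every other hypergraph may lose that
      many edges, in particular all those through a given vertex.\<close>
    have IHI: "\<exists>f. (\<forall>l\<in>I - {i}. f l \<in> H' l) \<and> disjoint_family_on f (I - {i})"
      if i: "i \<in> I" and sub: "\<And>l. l \<in> I \<Longrightarrow> H' l \<subseteq> H l"
        and big: "\<And>l. l \<in> I - {i} \<Longrightarrow> card (H l) \<le> card (H' l) + n ^ q" for i H'
    proof (rule psubset.IH)
      show "I - {i} \<subset> I" using i by blast
      have "card (I - {i}) - 1 \<le> card I - 1"
        using i psubset.hyps by simp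
      then have "3 * q * (card (I - {i}) - 1) \<le> 3 * q * (card I - 1)"
        by (rule mult_le_mono2)
      also note n
      finally show "3 * (Suc q - 1) * (card (I - {i}) - 1) \<le> n"
        by (simp only: diff_Suc_1)
      show "uniform_family (Suc q) (I - {i}) J H'"
        using fam sub unfolding uniform_family_def by blast
      fix l assume l: "l \<in> I - {i}"
      have "card (I - {i}) > 0"
        using l psubset.hyps by (metis card_gt_0_iff empty_iff finite_Diff)
      then obtain c where c: "card (I - {i}) = Suc c"
        using gr0_implies_Suc by blast
      then have "card I - 1 = Suc c"
        using i psubset.hyps by simp
      then have "Suc c * n ^ q < card (H' l) + n ^ q"
        using large[of l] big[OF l] l by fastforce
      then show "(card (I - {i}) - 1) * n ^ (Suc q - 1) < card (H' l)"
        using c by simp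
    qed
    show ?case
    proof (cases "\<exists>i\<in>I. \<exists>v. q * (card I - 1) * n ^ (q - 1) < degree (H i) v")
      case True
      then obtain i v where iv: "i \<in> I" "q * (card I - 1) * n ^ (q - 1) < degree (H i) v"
        by blast
      define H' where "H' = (\<lambda>l. {e \<in> H l. e \<inter> {v} = {}})"
      have "card (H l) \<le> card (H' l) + n ^ q" if "l \<in> I - {i}" for l
      proof -
        have l: "l \<in> I" using that by blast
        note Jl = uniform_familyD[OF fam l]
        have "degree (H l) v \<le> n ^ q"
          using degree_le[OF Jl(4,1,2), of v] Jl(3) by simp
        then show ?thesis
          using card_edges_avoiding_ge[OF Jl(5), of "{v}"] by (simp add: H'_def)
      qed
      then obtain e where e: "\<forall>l\<in>I - {i}. e l \<in> H' l" "disjoint_family_on e (I - {i})"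
        using IHI[OF iv(1), of H'] by (auto simp: H'_def)
      show ?thesis
        by (rule extend_at_heavy_vertex[OF fam psubset.hyps iv _ _ e(2)])
          (use e(1) in \<open>auto simp: H'_def\<close>)
    next
      case False
      then have bounded: "degree (H i) v \<le> q * (card I - 1) * n ^ (q - 1)" if "i \<in> I" for i v
        using that by (meson not_less)
      define A where "A = (\<lambda>i. {v. 2 * (card I - 1) * n ^ (q - 1) < degree (H i) v})"
      have finA: "finite (A i)" if "i \<in> I" for i
      proof (rule finite_subset)
        note Ji = uniform_familyD[OF fam that]
        show "finite (\<Union> (U ` J i))"
          using Ji(1,2) finite_class by auto
        show "A i \<subseteq> \<Union> (U ` J i)"
        proof
          fix v assume "v \<in> A i"
          then have "0 < degree (H i) v" unfolding A_def by auto
          then show "v \<in> \<Union> (U ` J i)"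
            using degree_pos_class[OF Ji(4)] by blast
        qed
      qed
      show ?thesis
      proof (cases "\<exists>i\<in>I. card (A i) \<le> card I - 1")
        case True
        then obtain i where i: "i \<in> I" "card (A i) \<le> card I - 1" by blast
        obtain e where e: "\<forall>l\<in>I - {i}. e l \<in> H l" "disjoint_family_on e (I - {i})"
          using IHI[OF i(1), of H] by auto
        show ?thesis
          by (rule extend_with_few_heavy_vertices[OF fam psubset.hyps i(1) \<open>1 \<le> q\<close> n
                large[OF i(1)] bounded[OF i(1)] i(2)[unfolded A_def]
                finA[OF i(1), unfolded A_def] _ e(2)])
            (use e(1) in blast)
      next
        case False
        then have "card I \<le> card (A i)" if "i \<in> I" for i
          using that by fastforce
        then obtain v where v: "\<forall>i\<in>I. v i \<in> A i" "inj_on v I"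
          using distinct_representatives[OF psubset.hyps, of A] by blast
        have "3 * (q - 1) * (card I - 1) \<le> 3 * q * (card I - 1)"
          by (intro mult_le_mono) auto
        then have "3 * (q - 1) * (card I - 1) \<le> n"
          using n by linarith
        then show ?thesis
          using v(1) by (intro reduce_to_links[OF fam psubset.hyps _ v(2)] IHq psubset.hyps)
            (auto simp: A_def)
      qed
    qed
  qed
qed

end

section \<open>From tuples to transversals\<close>

text \<open>Disjointness of the classes lets the entry in position \<open>j\<close> be recovered from the set of entries;
  both the injectivity of the passage from tuples to sets and the transversality of the
  resulting sets follow from this.\<close>

lemma tuple_entry_unique:
  assumes "disjoint_family_on U P" and "inj_on d {1..r}" and "d ` {1..r} \<subseteq> P"
    and "u \<in> (\<Pi>\<^sub>E j\<in>{1..r}. U (d j))" and "j \<in> {1..r}" 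
  shows "edge_of_tuple r u \<inter> U (d j) = {u j}"
proof -
  have u: "u l \<in> U (d l)" if "l \<in> {1..r}" for l
    using assms(4) that by (rule PiE_mem)
  have "l = j" if "l \<in> {1..r}" "u l \<in> U (d j)" for l
  proof (rule ccontr)
    assume "l \<noteq> j"
    then have "d l \<noteq> d j" using assms(2,5) that(1) by (auto dest: inj_onD)
    then show False
      using assms(1,3,5) that u[OF that(1)] unfolding disjoint_family_on_def by blast
  qed
  then show ?thesis
    unfolding edge_of_tuple_def using u[OF assms(5)] assms(5) by blast
qed

lemma edge_of_tuple_transversal:
  assumes "disjoint_family_on U P" and "inj_on d {1..r}" and "d ` {1..r} \<subseteq> P"
    and "u \<in> (\<Pi>\<^sub>E j\<in>{1..r}. U (d j))"
  shows "edge_of_tuple r u \<in> transversals U (d ` {1..r})"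
proof -
  have "edge_of_tuple r u \<subseteq> \<Union> (U ` d ` {1..r})"
    using PiE_mem[OF assms(4)] unfolding edge_of_tuple_def by blast
  moreover have "\<exists>!x. x \<in> edge_of_tuple r u \<inter> U p" if "p \<in> d ` {1..r}" for p
  proof -
    obtain j where "p = d j" "j \<in> {1..r}" using \<open>p \<in> d ` {1..r}\<close> by blast
    then have "edge_of_tuple r u \<inter> U p = {u j}"
      using tuple_entry_unique[OF assms] by simp
    then show ?thesis by simp
  qed
  ultimately show ?thesis
    unfolding transversals_def by blast
qed

lemma inj_on_edge_of_tuple:
  assumes "disjoint_family_on U P" and "inj_on d {1..r}" and "d ` {1..r} \<subseteq> P"
  shows "inj_on (edge_of_tuple r) (\<Pi>\<^sub>E j\<in>{1..r}. U (d j))"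
proof (rule inj_onI)
  fix u w assume u: "u \<in> (\<Pi>\<^sub>E j\<in>{1..r}. U (d j))" and w: "w \<in> (\<Pi>\<^sub>E j\<in>{1..r}. U (d j))"
    and eq: "edge_of_tuple r u = edge_of_tuple r w"
  show "u = w"
  proof (rule PiE_ext[OF u w])
    fix j assume "j \<in> {1..r}"
    then show "u j = w j"
      using tuple_entry_unique[OF assms u] tuple_entry_unique[OF assms w] eq by auto
  qed
qed

theorem theorem1p2:
  fixes k r n t :: nat
    and U :: "nat \<Rightarrow> 'a set"
    and ind :: "nat \<Rightarrow> nat \<Rightarrow> nat"
    and F :: "nat \<Rightarrow> (nat \<Rightarrow> 'a) set"
  assumes "k > 0" and "r > 0" and "n > 0" and "t > 0"
    and "2 \<le> r" and "r \<le> k"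
    and "n \<ge> 3 * (k - 1) * (t - 1)"
    and "disjoint_family_on U {1..k}"
    and "\<And>i. i \<in> {1..k} \<Longrightarrow> card (U i) = n"
    and "\<And>i j. i \<in> {1..t} \<Longrightarrow> j \<in> {1..r} \<Longrightarrow> ind i j \<in> {1..k}"
    and "\<And>i. i \<in> {1..t} \<Longrightarrow> inj_on (ind i) {1..r}"
    and "\<And>i. i \<in> {1..t} \<Longrightarrow> F i \<subseteq> (\<Pi>\<^sub>E j\<in>{1..r}. U (ind i j))"
    and "\<And>i. i \<in> {1..t} \<Longrightarrow> card (F i) > (t - 1) * n ^ (r - 1)"
  shows "admits_rainbow_matching t (\<lambda>i. hyperedges r (F i))"
proof -
  interpret vertex_classes U "{1..k}" n
  proof
    fix p assume "p \<in> {1..k}"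
    then have "card (U p) = n" by (rule assms(9))
    then show "finite (U p)" "card (U p) \<le> n"
      using \<open>n > 0\<close> card_gt_0_iff[of "U p"] by simp_all
  qed (rule assms(8))
  have ind: "ind i ` {1..r} \<subseteq> {1..k}" if "i \<in> {1..t}" for i
    using assms(10)[OF that] by blast
  have card_edges: "card (hyperedges r (F i)) = card (F i)" if "i \<in> {1..t}" for i
    unfolding hyperedges_def
    using inj_on_subset[OF inj_on_edge_of_tuple[OF assms(8,11) ind] assms(12)] that
    by (intro card_image) blast
  have "\<exists>f. (\<forall>i\<in>{1..t}. f i \<in> hyperedges r (F i)) \<and> disjoint_family_on f {1..t}"
  proof (rule rainbow_matching_of_transversals)
    have "3 * (r - 1) * (t - 1) \<le> 3 * (k - 1) * (t - 1)"
      using \<open>r \<le> k\<close> by (intro mult_le_mono) auto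
    also note assms(7)
    finally show "3 * (r - 1) * (card {1..t} - 1) \<le> n"
      by (simp only: card_atLeastAtMost diff_Suc_1)
    show "uniform_family r {1..t} (\<lambda>i. ind i ` {1..r}) (\<lambda>i. hyperedges r (F i))"
      unfolding uniform_family_def
    proof (intro ballI conjI)
      fix i assume i: "i \<in> {1..t}"
      show "ind i ` {1..r} \<subseteq> {1..k}" by (rule ind[OF i])
      show "finite (ind i ` {1..r})" by simp
      show "card (ind i ` {1..r}) = r"
        using card_image[OF assms(11)[OF i]] by simp
      show "hyperedges r (F i) \<subseteq> transversals U (ind i ` {1..r})"
        using edge_of_tuple_transversal[OF assms(8) assms(11)[OF i] ind[OF i]] assms(12)[OF i]
        unfolding hyperedges_def by blast
    qed
  qed (use assms(13) card_edges \<open>r > 0\<close> in auto)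
  then show ?thesis
    unfolding admits_rainbow_matching_def rainbow_matching_def .
qed

end
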